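(* Let $A$ be an expansive, integer valued $n\times n$ matrix with determinant $2$. Then: (1) there is no compact, centrally symmetric set $K\subset\mathbb{R}^n$ which tiles $\mathbb{R}^n$ by $\mathbb{Z}^n$ translations such that $A(K^\circ)\supset K$; (2) there is no compact, convex set $K\subset\mathbb{R}^n$ which tiles $\mathbb{R}^n$ by $\mathbb{Z}^n$ translations such that $A(K^\circ)\supset K$; and (3) there is no compact set $K\subset\mathbb{R}^n$ whose boundary $\partial K$ is connected and which tiles $\mathbb{R}^n$ by $\mathbb{Z}^n$ translations such that $A(K^\circ)\supset K$.
   Context: An $n\times n$ integer matrix is expansive if all of its (complex) eigenvalues have modulus larger than $1$. $K^\circ$ denotes the interior of $K$. A set $K$ is centrally symmetric if $K=-K$. A measurable set $K$ tiles $\mathbb{R}^n$ by $\mathbb{Z}^n$ translations if $\sum_{k\in\mathbb{Z}^n} I_K(x+k)=1$ for almost every $x\in\mathbb{R}^n$, where $I_K$ is the indicator function of $K$.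
   Formalization: Parts (1) and (2) are stated for n ≥ 2 only: for n = 1 they are false, since A = (2) and K = [-1/2, 1/2] satisfy every condition; part (3) is stated for all n ≥ 1. *)

theory Defs
  imports "HOL-Analysis.Analysis"
begin

definition complex_eigenvalue :: "int ^ 'n ^ 'n \<Rightarrow> complex \<Rightarrow> bool" where
  "complex_eigenvalue A \<mu> \<longleftrightarrow>
     (\<exists>v :: complex ^ 'n. v \<noteq> 0 \<and> map_matrix of_int A *v v = \<mu> *s v)"

definition expansive :: "int ^ 'n ^ 'n \<Rightarrow> bool" where
  "expansive A \<longleftrightarrow> (\<forall>\<mu>. complex_eigenvalue A \<mu> \<longrightarrow> norm \<mu> > 1)"

definition matrix_action :: "int ^ 'n ^ 'n \<Rightarrow> real ^ 'n \<Rightarrow> real ^ 'n" where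
  "matrix_action A x = map_matrix of_int A *v x"

definition integer_lattice :: "(real ^ 'n) set" where
  "integer_lattice = {k. \<forall>i. k $ i \<in> \<int>}"

definition tiles_by_integers :: "(real ^ 'n) set \<Rightarrow> bool" where
  "tiles_by_integers K \<longleftrightarrow> K \<in> sets lebesgue \<and>
     (AE x in lebesgue. ((\<lambda>k. indicator K (x + k) :: real) has_sum 1) integer_lattice)"

definition centrally_symmetric :: "'a :: group_add set \<Rightarrow> bool" where
  "centrally_symmetric K \<longleftrightarrow> K = uminus ` K"

end

theory Submission
  imports Defs
begin

text \<open>
  Write \<open>L\<close> for the integer lattice and \<open>AL\<close> for its image under \<open>A\<close>.  Two translates of \<open>K\<close>
  by distinct vectors of \<open>L\<close> have disjoint interiors, so two translates of \<open>A(K\<degree>)\<close> by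
  distinct vectors of \<open>AL\<close> are disjoint.  As \<open>K\<close> is contained in \<open>A(K\<degree>)\<close>, the compact sets
  \<open>K + p\<close> with \<open>p \<in> AL\<close> are pairwise disjoint, boundaries included
  (\<open>refinable_tile_translates_disjoint\<close>).  On the other hand the translates by all of \<open>L\<close> cover
  the whole space (\<open>compact_tile_covers\<close>).  Since \<open>det A = 2\<close>, the sublattice \<open>AL\<close> has index two
  (\<open>lattice_image_index_two\<close>), so the translates by the other coset of \<open>AL\<close> are pairwise
  disjoint as well.

  A boundary point of \<open>K\<close> is not in any other \<open>K + p\<close> with \<open>p \<in> AL\<close>, hence it lies in some
  \<open>K + p\<close> with \<open>p \<notin> AL\<close>.  These translates are disjoint, closed and locally finite, so a connected
  boundary is contained in a single one of them.  But a point of \<open>K\<close> that is extremal in the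
  direction \<open>- p\<close> is a boundary point outside \<open>K + p\<close>.  This excludes connected boundaries, and a
  compact convex set in dimension at least two has a connected boundary.

  If \<open>K = - K\<close> and \<open>l \<in> AL\<close>, the covering gives a point \<open>x \<in> K\<close> congruent to \<open>l / 2\<close> modulo \<open>L\<close>.
  Then \<open>- x \<in> K\<close>, and \<open>x - (- x) = 2 x\<close> is in \<open>l + 2 L\<close>, hence in \<open>AL\<close>, because
  \<open>2 L \<subseteq> AL\<close>.  Disjointness forces \<open>x = 0\<close>, so \<open>l \<in> 2 L\<close>.  Thus \<open>AL \<subseteq> 2 L\<close>, which contradicts
  index two when the dimension is at least two.
\<close>

section \<open>The image of the integer lattice under a matrix of determinant two\<close>

lemma integer_lattice_uminus: "x \<in> integer_lattice \<Longrightarrow> - x \<in> integer_lattice"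
  and integer_lattice_add: "x \<in> integer_lattice \<Longrightarrow> y \<in> integer_lattice \<Longrightarrow> x + y \<in> integer_lattice"
  by (auto simp: integer_lattice_def)

lemma zero_in_integer_lattice: "0 \<in> integer_lattice"
  by (auto simp: integer_lattice_def)

lemma det_of_int_matrix:
  fixes A :: "int ^ 'n ^ 'n"
  shows "det (map_matrix of_int A :: real ^ 'n ^ 'n) = of_int (det A)"
  by (simp add: det_def)

lemma Ints_det:
  fixes M :: "real ^ 'n ^ 'n"
  assumes "\<And>i j. M $ i $ j \<in> \<int>"
  shows "det M \<in> \<int>"
  unfolding det_def using assms by (intro Ints_sum Ints_mult Ints_prod Ints_of_int) auto

text \<open>By Cramer's rule, \<open>x $ k * det M\<close> is the determinant of an integer matrix.\<close>

lemma Ints_solution_times_det: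
  fixes M :: "real ^ 'n ^ 'n"
  assumes "\<And>i j. M $ i $ j \<in> \<int>" "M *v x \<in> integer_lattice"
  shows "x $ k * det M \<in> \<int>"
  unfolding cramer_lemma[symmetric] using assms
  by (intro Ints_det) (auto simp: integer_lattice_def)

lemma lattice_half_preimage:
  fixes M :: "real ^ 'n ^ 'n"
  assumes int: "\<And>i j. M $ i $ j \<in> \<int>" and det: "det M = 2" and k: "k \<in> integer_lattice"
  obtains y a where "M *v y = k" "\<And>i. y $ i = of_int (a i) / 2"
proof -
  obtain y where y: "M *v y = k"
    using cramer[of M _ k] det by auto
  have "\<exists>a. y $ i = of_int a / 2" for i
    using Ints_solution_times_det[OF int, of y i] y k det
    by (auto elim!: Ints_cases simp: field_simps)
  then show thesis
    using y that by metis
qed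

text \<open>
  The preimage of an integer vector \<open>k\<close> has the form \<open>a / 2\<close> with \<open>a\<close> an integer vector, and \<open>k\<close> is
  in the image lattice exactly when \<open>a\<close> is even.  So the claim says that the admissible vectors \<open>a\<close>
  span at most a line over the field with two elements: otherwise replacing two columns of the
  matrix would show that its determinant is divisible by four.
\<close>

lemma lattice_image_index_two:
  fixes M :: "real ^ 'n ^ 'n"
  assumes int: "\<And>i j. M $ i $ j \<in> \<int>" and det: "det M = 2"
    and k: "k \<in> integer_lattice" "k \<notin> (*v) M ` integer_lattice"
    and k': "k' \<in> integer_lattice" "k' \<notin> (*v) M ` integer_lattice"
  shows "k - k' \<in> (*v) M ` integer_lattice"
proof -
  obtain y a where y: "M *v y = k" and a: "\<And>i. y $ i = of_int (a i) / 2"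
    using lattice_half_preimage[OF int det k(1)] by blast
  obtain z b where z: "M *v z = k'" and b: "\<And>i. z $ i = of_int (b i) / 2"
    using lattice_half_preimage[OF int det k'(1)] by blast
  have odd_entry: "\<exists>i. odd (c i)"
    if "M *v x = l" "l \<notin> (*v) M ` integer_lattice" "\<And>i. x $ i = of_int (c i) / 2"
    for x l and c :: "'n \<Rightarrow> int"
  proof (rule ccontr)
    assume "\<nexists>i. odd (c i)"
    then have "x $ i = of_int (c i div 2)" for i
      using that(3) by (simp add: real_of_int_div)
    then have "x \<in> integer_lattice"
      by (auto simp: integer_lattice_def)
    with that show False by blast
  qed
  obtain i where i: "odd (a i)"
    using odd_entry[OF y k(2) a] by blast
  obtain j where j: "odd (b j)"
    using odd_entry[OF z k'(2) b] by blast
  \<comment> \<open>Column \<open>i\<close> becomes \<open>k\<close>, which trades the determinant two for the odd number \<open>a i\<close>: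
    Cramer's rule for \<open>C\<close> then has no factor two that could hide the parity of its solutions.\<close>
  define C :: "real ^ 'n ^ 'n" where "C = (\<chi> r s. if s = i then (M *v y) $ r else M $ r $ s)"
  have detC: "det C = of_int (a i)"
    unfolding C_def cramer_lemma using det a by simp
  have intC: "C $ r $ s \<in> \<int>" for r s
    using int k(1) by (auto simp: C_def y integer_lattice_def)
  \<comment> \<open>This combination has a zero entry at \<open>i\<close>, so \<open>C\<close> and \<open>M\<close> agree on it.\<close>
  define w where "w = of_int (a i) *s z - of_int (b i) *s y"
  have wi: "w $ i = 0"
    by (simp add: w_def a b)
  have "C *v w = M *v w"
    using wi by (auto simp: C_def vec_eq_iff matrix_vector_mult_def intro!: sum.cong)
  also have "\<dots> = of_int (a i) *s k' - of_int (b i) *s k"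
    by (simp add: w_def matrix_vector_mult_diff_distrib vector_scalar_commute y z)
  also have "\<dots> \<in> integer_lattice"
    using k(1) k'(1) by (auto simp: integer_lattice_def)
  finally have Cw: "C *v w \<in> integer_lattice" .
  have minor: "even (a i * b s - b i * a s)" for s
  proof -
    obtain m where m: "w $ s * det C = of_int m"
      using Ints_solution_times_det[OF intC Cw] by (auto elim: Ints_cases)
    then have "real_of_int ((a i * b s - b i * a s) * a i) = real_of_int (2 * m)"
      by (simp add: w_def a b detC field_simps)
    then have "(a i * b s - b i * a s) * a i = 2 * m"
      using of_int_eq_iff by blast
    then have "even ((a i * b s - b i * a s) * a i)"
      by simp
    then show ?thesis
      using i by simp
  qed
  have "odd (b i)"
    using minor[of j] i j by auto
  then have "even (a s - b s)" for s
    using minor[of s] i by simp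
  then have "\<exists>m. a s - b s = 2 * m" for s
    by (metis evenE)
  then obtain m where m: "\<And>s. a s - b s = 2 * m s"
    by metis
  have "(y - z) $ s = of_int (m s)" for s
  proof -
    have "(y - z) $ s = of_int (a s - b s) / 2"
      by (simp add: a b field_simps)
    then show ?thesis
      by (simp add: m)
  qed
  then have "y - z \<in> integer_lattice"
    by (auto simp: integer_lattice_def)
  moreover have "M *v (y - z) = k - k'"
    by (simp add: matrix_vector_mult_diff_distrib y z)
  ultimately show ?thesis
    by (metis imageI)
qed

lemma double_lattice_subset_image:
  fixes M :: "real ^ 'n ^ 'n"
  assumes "\<And>i j. M $ i $ j \<in> \<int>" "det M = 2" "k \<in> integer_lattice"
  shows "2 *\<^sub>R k \<in> (*v) M ` integer_lattice"
proof -
  obtain y a where y: "M *v y = k" "\<And>i. y $ i = of_int (a i) / 2"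
    using lattice_half_preimage[OF assms] by blast
  then have "2 *\<^sub>R k = M *v (2 *\<^sub>R y)"
    by (simp add: matrix_vector_mult_scaleR)
  moreover have "2 *\<^sub>R y \<in> integer_lattice"
    unfolding integer_lattice_def by (simp add: y(2) del: divide_eq_eq_numeral1)
  ultimately show ?thesis
    by blast
qed

text \<open>If the image were contained in \<open>2 L\<close>, two distinct unit vectors and their difference would all lie
  outside the image, which has index two.\<close>

lemma lattice_image_not_even:
  fixes M :: "real ^ 'n ^ 'n"
  assumes int: "\<And>i j. M $ i $ j \<in> \<int>" and det: "det M = 2" and card: "CARD('n) \<ge> 2"
  shows "\<not> (*v) M ` integer_lattice \<subseteq> (*\<^sub>R) 2 ` integer_lattice"
proof
  assume sub: "(*v) M ` integer_lattice \<subseteq> (*\<^sub>R) 2 ` integer_lattice"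
  have not_even: "v \<notin> (*v) M ` integer_lattice" if "v $ i = 1" for v :: "real ^ 'n" and i
  proof
    assume "v \<in> (*v) M ` integer_lattice"
    then obtain u where "u \<in> integer_lattice" "v = 2 *\<^sub>R u"
      using sub by blast
    moreover from this obtain m where "u $ i = real_of_int m"
      by (auto simp: integer_lattice_def elim: Ints_cases)
    ultimately have "real_of_int 1 = real_of_int (2 * m)"
      using that by simp
    then have "1 = 2 * m"
      by (simp only: of_int_eq_iff)
    then show False
      by presburger
  qed
  obtain i j :: 'n where "i \<noteq> j"
    using card card_le_Suc0_iff_eq[of "UNIV :: 'n set"] by fastforce
  have "axis l 1 \<in> integer_lattice" for l :: 'n
    by (simp add: integer_lattice_def axis_def)
  then have "axis i 1 - axis j 1 \<in> (*v) M ` integer_lattice"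
    using not_even[of "axis i 1" i] not_even[of "axis j 1" j]
    by (intro lattice_image_index_two[OF int det]) auto
  moreover have "(axis i 1 - axis j 1 :: real ^ 'n) $ i = 1"
    using \<open>i \<noteq> j\<close> by (simp add: axis_def)
  ultimately show False
    using not_even by blast
qed

section \<open>Compact tiles\<close>

lemma closed_subset_integer_lattice:
  assumes "P \<subseteq> integer_lattice"
  shows "closed P"
proof (rule discrete_imp_closed[of 1])
  show "\<forall>x\<in>P. \<forall>y\<in>P. dist y x < 1 \<longrightarrow> y = x"
  proof (intro ballI impI)
    fix x y assume xy: "x \<in> P" "y \<in> P" "dist y x < 1"
    have "y $ i = x $ i" for i
    proof -
      have "x $ i \<in> \<int>" "y $ i \<in> \<int>"
        using xy assms by (auto simp: integer_lattice_def)
      moreover have "dist (y $ i) (x $ i) < 1"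
        using dist_vec_nth_le[of y i x] xy by simp
      ultimately show ?thesis
        by (auto elim!: Ints_cases simp: dist_of_int)
    qed
    then show "y = x"
      by (simp add: vec_eq_iff)
  qed
qed simp

lemma closed_lattice_translates:
  assumes "compact K" "P \<subseteq> integer_lattice"
  shows "closed (\<Union>x\<in>K. \<Union>p\<in>P. {x + p})"
  using assms by (intro compact_closed_sums closed_subset_integer_lattice)

text \<open>The union of the translates is closed and of full measure.\<close>

lemma compact_tile_covers:
  assumes "compact K" and tile: "tiles_by_integers K"
  shows "\<exists>k\<in>integer_lattice. x + k \<in> K"
proof -
  let ?C = "\<Union>x\<in>K. \<Union>k\<in>integer_lattice. {x + k}"
  have "AE x in lebesgue. x \<in> ?C"
    using conjunct2[OF tile[unfolded tiles_by_integers_def]]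
  proof eventually_elim
    case (elim x)
    have "\<exists>k\<in>integer_lattice. x + k \<in> K"
    proof (rule ccontr)
      assume "\<not> ?thesis"
      then have "((\<lambda>k. indicator K (x + k) :: real) has_sum 0) integer_lattice"
        by (intro has_sum_0) auto
      with elim show False
        using has_sum_unique by fastforce
    qed
    then obtain k where "k \<in> integer_lattice" "x + k \<in> K" by blast
    moreover from this have "x \<in> {x + k + - k}" "- k \<in> integer_lattice"
      by (simp_all add: integer_lattice_uminus)
    ultimately show ?case
      by blast
  qed
  then have "x \<in> ?C"
    using mem_closed_if_AE_lebesgue closed_lattice_translates[OF \<open>compact K\<close>] by blast
  then obtain y k where "y \<in> K" "k \<in> integer_lattice" "x = y + k"
    by blast
  then show ?thesis
    by (auto intro!: bexI[of _ "- k"] integer_lattice_uminus)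
qed

text \<open>A common point would give an open set on which the tiling sum is at least two.\<close>

lemma tile_interiors_disjoint:
  assumes tile: "tiles_by_integers K" and p: "p \<in> integer_lattice"
    and x: "x \<in> interior K" "x - p \<in> interior K"
  shows "p = 0"
proof (rule ccontr)
  assume "p \<noteq> 0"
  let ?U = "interior K \<inter> (\<lambda>x. x - p) -` interior K"
  have "open ?U"
    by (intro open_Int open_vimage) (auto intro!: continuous_intros)
  moreover have "AE x in lebesgue. x \<in> - ?U"
    using conjunct2[OF tile[unfolded tiles_by_integers_def]]
  proof eventually_elim
    case (elim x)
    have "(\<Sum>k\<in>{0, - p}. indicator K (x + k) :: real) \<le> 1"
      using elim p
      by (intro finite_sum_le_has_sum[OF elim])
        (auto simp: integer_lattice_uminus zero_in_integer_lattice)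
    then have "\<not> (x \<in> K \<and> x - p \<in> K)"
      using \<open>p \<noteq> 0\<close> by (auto simp del: sum_indicator_eq_card)
    then show ?case
      using interior_subset[of K] by auto
  qed
  ultimately have "x \<in> - ?U"
    by (intro mem_closed_if_AE_lebesgue closed_Compl)
  with x show False
    by simp
qed

lemma refinable_tile_translates_disjoint:
  assumes tile: "tiles_by_integers K" and "inj ((*v) M)" and sub: "K \<subseteq> (*v) M ` interior K"
    and p: "p \<in> (*v) M ` integer_lattice" and x: "x \<in> K" "x - p \<in> K"
  shows "p = 0"
proof -
  obtain y z k where "y \<in> interior K" "z \<in> interior K" "k \<in> integer_lattice"
    "x = M *v y" "x - p = M *v z" "p = M *v k"
    using sub p x by blast
  moreover from this have "z = y - k"
    using \<open>inj ((*v) M)\<close> by (metis injD matrix_vector_mult_diff_distrib)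
  ultimately show ?thesis
    using tile_interiors_disjoint[OF tile, of k y] by simp
qed

section \<open>Tiles with connected boundary\<close>

text \<open>A point of \<open>K\<close> where the inner product with \<open>p\<close> is minimal is not in \<open>K + p\<close>.\<close>

lemma frontier_not_subset_translate:
  fixes K :: "'a :: euclidean_space set"
  assumes "compact K" "K \<noteq> {}" "p \<noteq> 0"
  shows "\<exists>x\<in>frontier K. x - p \<notin> K"
proof -
  obtain x where x: "x \<in> K" "\<And>y. y \<in> K \<Longrightarrow> p \<bullet> x \<le> p \<bullet> y"
    using continuous_attains_inf[OF assms(1,2) continuous_on_inner[OF continuous_on_const continuous_on_id],
        of p] by auto
  have lower: "p \<bullet> (x - t *\<^sub>R p) < p \<bullet> x" if "t > 0" for t
    using that \<open>p \<noteq> 0\<close> by (simp add: inner_diff_right)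
  have "x \<notin> interior K"
  proof
    assume "x \<in> interior K"
    then obtain e where e: "e > 0" "cball x e \<subseteq> K"
      by (auto simp: mem_interior_cball)
    then have "x - (e / norm p) *\<^sub>R p \<in> K"
      using \<open>p \<noteq> 0\<close> by (intro subsetD[OF e(2)]) (simp add: dist_norm)
    then show False
      using x(2) lower[of "e / norm p"] e(1) \<open>p \<noteq> 0\<close> by fastforce
  qed
  then have "x \<in> frontier K"
    using x(1) closure_subset by (auto simp: frontier_def)
  moreover have "x - p \<notin> K"
    using x(2) lower[of 1] by fastforce
  ultimately show ?thesis ..
qed

text \<open>
  One of the translates and the union of all others are disjoint closed sets, the latter because
  every set of lattice vectors is closed.  So a connected boundary would lie in a single translate.
\<close>

lemma connected_frontier_not_covered:
  fixes K :: "(real ^ 'n) set"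
  assumes "compact K" "K \<noteq> {}" and conn: "connected (frontier K)"
    and P: "P \<subseteq> integer_lattice" "0 \<notin> P"
    and cover: "\<And>x. x \<in> frontier K \<Longrightarrow> \<exists>p\<in>P. x - p \<in> K"
    and disj: "\<And>x p q. p \<in> P \<Longrightarrow> q \<in> P \<Longrightarrow> x - p \<in> K \<Longrightarrow> x - q \<in> K \<Longrightarrow> p = q"
  shows False
proof -
  define T where "T Q = (\<Union>x\<in>K. \<Union>p\<in>Q. {x + p})" for Q
  have T: "x \<in> T Q \<longleftrightarrow> (\<exists>p\<in>Q. x - p \<in> K)" for x Q
    unfolding T_def by (force intro: bexI[of _ "x - _"])
  have closed_T: "closed (T Q)" if "Q \<subseteq> P" for Q
    unfolding T_def using that P(1) \<open>compact K\<close> by (intro closed_lattice_translates) auto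
  have "\<exists>x. x \<in> frontier K"
    using frontier_not_subset_translate[OF assms(1,2), of 1] by auto
  then obtain x p where x: "x \<in> frontier K" and p: "p \<in> P" "x - p \<in> K"
    using cover by blast
  have "T {p} \<inter> frontier K = {} \<or> T (P - {p}) \<inter> frontier K = {}"
  proof (rule connected_closedD[OF conn])
    show "T {p} \<inter> T (P - {p}) \<inter> frontier K = {}"
      using disj p(1) by (auto simp: T)
    show "frontier K \<subseteq> T {p} \<union> T (P - {p})"
      using cover by (fastforce simp: T)
  qed (use closed_T p(1) in auto)
  then have "T (P - {p}) \<inter> frontier K = {}"
    using x p by (auto simp: T)
  then have "y - p \<in> K" if "y \<in> frontier K" for y
    using cover[OF that] that T[of y "P - {p}"] by blast
  moreover have "p \<noteq> 0"
    using p(1) P(2) by blast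
  ultimately show False
    using frontier_not_subset_translate[OF assms(1,2)] by blast
qed

lemma refinable_tile_frontier_not_connected:
  fixes M :: "real ^ 'n ^ 'n"
  assumes int: "\<And>i j. M $ i $ j \<in> \<int>" and det: "det M = 2"
    and K: "compact K" "tiles_by_integers K" "K \<subseteq> (*v) M ` interior K"
  shows "\<not> connected (frontier K)"
proof
  assume conn: "connected (frontier K)"
  let ?AL = "(*v) M ` integer_lattice"
  let ?P = "integer_lattice - ?AL"
  have "inj ((*v) M)"
    using det by (intro inj_matrix_vector_mult) (simp add: invertible_det_nz)
  note disjoint = refinable_tile_translates_disjoint[OF K(2) this K(3)]
  have AL: "?AL \<subseteq> integer_lattice"
    using int by (auto simp: integer_lattice_def matrix_vector_mult_def intro!: Ints_sum Ints_mult)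
  have "K \<noteq> {}"
    using compact_tile_covers[OF K(1,2)] by blast
  then show False
  proof (rule connected_frontier_not_covered[OF K(1) _ conn])
    show "0 \<notin> ?P"
      using zero_in_integer_lattice by (auto simp: image_iff intro!: bexI[of _ 0])
    show "p = q" if "p \<in> ?P" "q \<in> ?P" "x - p \<in> K" "x - q \<in> K" for x p q
      using disjoint[of "q - p" "x - p"] lattice_image_index_two[OF int det, of q p] that by simp
    show "\<exists>p\<in>?P. x - p \<in> K" if x: "x \<in> frontier K" for x
    proof (rule ccontr)
      assume none: "\<not> ?thesis"
      \<comment> \<open>All points of a neighbourhood of \<open>x\<close> are covered by \<open>K\<close> itself.\<close>
      define C where "C = (\<Union>y\<in>K. \<Union>p\<in>integer_lattice - {0}. {y + p})"
      have "closed C"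
        unfolding C_def using K(1) by (intro closed_lattice_translates) auto
      have "x \<in> K"
        using x K(1) by (metis compact_imp_closed frontier_subset_closed subsetD)
      then have "x \<notin> C"
        using disjoint[of _ x] none by (force simp: C_def)
      moreover have "- C \<subseteq> K"
      proof
        fix y assume y: "y \<in> - C"
        obtain k where k: "k \<in> integer_lattice" "y + k \<in> K"
          using compact_tile_covers[OF K(1,2)] by blast
        have "y \<in> C" if "k \<noteq> 0"
        proof -
          have "y \<in> {y + k + - k}" "- k \<in> integer_lattice - {0}"
            using that k by (simp_all add: integer_lattice_uminus)
          with k show ?thesis
            unfolding C_def by blast
        qed
        with y k show "y \<in> K"
          by fastforce
      qed
      ultimately have "x \<in> interior K"
        using \<open>closed C\<close> by (intro interiorI[of "- C"]) auto
      with x show False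
        by (simp add: frontier_def)
    qed
  qed auto
qed

section \<open>Centrally symmetric tiles\<close>

lemma refinable_tile_not_symmetric:
  fixes M :: "real ^ 'n ^ 'n"
  assumes int: "\<And>i j. M $ i $ j \<in> \<int>" and det: "det M = 2" and card: "CARD('n) \<ge> 2"
    and K: "compact K" "tiles_by_integers K" "K \<subseteq> (*v) M ` interior K"
  shows "\<not> centrally_symmetric K"
proof
  assume sym: "centrally_symmetric K"
  have "inj ((*v) M)"
    using det by (intro inj_matrix_vector_mult) (simp add: invertible_det_nz)
  note disjoint = refinable_tile_translates_disjoint[OF K(2) this K(3)]
  have "l \<in> (*\<^sub>R) 2 ` integer_lattice" if l: "l \<in> (*v) M ` integer_lattice" for l
  proof -
    obtain k where k: "k \<in> integer_lattice" "l /\<^sub>R 2 + k \<in> K"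
      using compact_tile_covers[OF K(1,2)] by blast
    then have "- (l /\<^sub>R 2 + k) \<in> K"
      using sym by (metis centrally_symmetric_def imageI)
    moreover have eq: "l /\<^sub>R 2 + k - (l + 2 *\<^sub>R k) = - (l /\<^sub>R 2 + k)"
      by (simp add: vec_eq_iff)
    moreover have "l + 2 *\<^sub>R k \<in> (*v) M ` integer_lattice"
    proof -
      obtain u v where "u \<in> integer_lattice" "v \<in> integer_lattice" "l = M *v u" "2 *\<^sub>R k = M *v v"
        using l double_lattice_subset_image[OF int det k(1)] by blast
      then have "l + 2 *\<^sub>R k = M *v (u + v)" "u + v \<in> integer_lattice"
        by (simp_all add: matrix_vector_right_distrib integer_lattice_add)
      then show ?thesis
        by blast
    qed
    ultimately have "l + 2 *\<^sub>R k = 0"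
      using disjoint k(2) by metis
    then have "l = 2 *\<^sub>R (- k)"
      by (simp add: eq_neg_iff_add_eq_0)
    then show ?thesis
      using integer_lattice_uminus[OF k(1)] by blast
  qed
  then show False
    using lattice_image_not_even[OF int det card] by blast
qed

section \<open>The nonexistence theorem\<close>

theorem theorem2p16:
  fixes A :: "int ^ 'n ^ 'n"
  assumes "expansive A" and "det A = 2"
  shows "(CARD('n) \<ge> 2 \<longrightarrow>
            \<not> (\<exists>K :: (real ^ 'n) set. compact K \<and> centrally_symmetric K \<and>
                 tiles_by_integers K \<and> matrix_action A ` interior K \<supseteq> K)) \<and>
         (CARD('n) \<ge> 2 \<longrightarrow>
            \<not> (\<exists>K :: (real ^ 'n) set. compact K \<and> convex K \<and>
                 tiles_by_integers K \<and> matrix_action A ` interior K \<supseteq> K)) \<and>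
         \<not> (\<exists>K :: (real ^ 'n) set. compact K \<and> connected (frontier K) \<and>
              tiles_by_integers K \<and> matrix_action A ` interior K \<supseteq> K)"
proof -
  define M :: "real ^ 'n ^ 'n" where "M = map_matrix of_int A"
  have action: "matrix_action A = (*v) M"
    by (auto simp: matrix_action_def M_def)
  have int: "M $ i $ j \<in> \<int>" for i j
    by (simp add: M_def)
  have det: "det M = 2"
    using assms(2) by (simp add: M_def det_of_int_matrix)
  have not_connected: "\<not> connected (frontier K)"
    if "compact K" "tiles_by_integers K" "K \<subseteq> (*v) M ` interior K" for K
    using refinable_tile_frontier_not_connected[OF int det that] .
  have "connected (frontier K)" if "CARD('n) \<ge> 2" "compact K" "convex K"
    for K :: "(real ^ 'n) set"
    using that
    by (intro connected_frontier_simple convex_connected connected_complement_bounded_convex)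
      (auto intro: compact_imp_bounded)
  then show ?thesis
    unfolding action
    using not_connected refinable_tile_not_symmetric[OF int det] by blast
qed

end
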